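(* For each integer $b\le -4$ there exist infinitely many valid digit sets $\mathcal{D}$ for the base $b$ with $0\in\mathcal{D}$, and infinitely many valid digit sets $\mathcal{D}$ for the base $b$ with $0\notin\mathcal{D}$.
   Context: For an integer $b$ with $|b|\ge 2$, a digit set is a set $\mathcal{D}\subset\mathbb{Z}$ with exactly $|b|$ elements containing exactly one element of each residue class modulo $b$. It is valid for $b$ if every $a\in\mathbb{Z}$ can be written as $a=\sum_{i=0}^{\ell-1}d_ib^i$ with $\ell\ge 1$ and all $d_i\in\mathcal{D}$. *)

theory Defs
  imports "HOL-Number_Theory.Cong"
begin

(* The base is meant to satisfy 2 <= |b|. *)
definition digit_set :: "int \<Rightarrow> int set \<Rightarrow> bool" where
  "digit_set b D \<longleftrightarrow>
     finite D \<and> card D = nat \<bar>b\<bar> \<and> (\<forall>a. \<exists>!d. d \<in> D \<and> [d = a] (mod b))"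

definition valid_digit_set :: "int \<Rightarrow> int set \<Rightarrow> bool" where
  "valid_digit_set b D \<longleftrightarrow>
     digit_set b D \<and>
     (\<forall>a. \<exists>l::nat. \<exists>d::nat \<Rightarrow> int.
        1 \<le> l \<and> (\<forall>i<l. d i \<in> D) \<and> a = (\<Sum>i<l. d i * b ^ i))"

end

theory Submission
  imports Defs
begin

text \<open>
  Write \<open>B = -b\<close>, take the digit set \<open>{z..<z + B}\<close> with \<open>z \<in> {0, 1}\<close>, and replace the digit \<open>3\<close> by
  \<open>3 - b ^ (n + 1)\<close>. One step of the digit expansion then agrees with a step for the interval
  digit set, except that the digit \<open>3\<close> adds \<open>b ^ n\<close> to the quotient. Hence an
  integer written as \<open>s + p\<close>, where \<open>p\<close> is a sum of distinct powers \<open>b ^ j\<close>, \<open>j \<le> n\<close>, is sent to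
  a number of the same shape whose small part \<open>s\<close> shrinks until it lies in \<open>{0, 1}\<close>. From then on the
  digit is read off from one of \<open>0\<close>, \<open>1\<close>, \<open>2\<close>, so since \<open>B \<ge> 4\<close> it is never \<open>3\<close>, and \<open>p\<close> is used up
  after at most \<open>n + 1\<close> steps. Finally \<open>0\<close> and \<open>1\<close> are representable themselves.
\<close>

section \<open>Digit expansions in Horner form\<close>

text \<open>The least significant digit is peeled off first. The base case is a single digit, not
  the empty expansion, so \<open>0\<close> needs a genuine expansion even if it is not a
  digit.\<close>

inductive representable :: "int \<Rightarrow> int set \<Rightarrow> int \<Rightarrow> bool" for b D where
  digit: "d \<in> D \<Longrightarrow> representable b D d"
| step: "d \<in> D \<Longrightarrow> representable b D a \<Longrightarrow> representable b D (d + b * a)"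

lemma representable_imp_sum:
  assumes "representable b D a"
  shows "\<exists>l::nat. \<exists>d::nat \<Rightarrow> int. 1 \<le> l \<and> (\<forall>i<l. d i \<in> D) \<and> a = (\<Sum>i<l. d i * b ^ i)"
  using assms
proof induction
  case (digit d)
  then show ?case by (intro exI[of _ 1] exI[of _ "\<lambda>_. d"]) simp
next
  case (step c a)
  then obtain l d where d: "\<forall>i<l. d i \<in> D" "a = (\<Sum>i<l. d i * b ^ i)" by blast
  have "c + b * a = (\<Sum>i<Suc l. case_nat c d i * b ^ i)"
    unfolding d(2) sum.lessThan_Suc_shift by (simp add: sum_distrib_left algebra_simps)
  moreover have "\<forall>i<Suc l. case_nat c d i \<in> D"
    using d(1) step.hyps by (auto split: nat.split)
  ultimately show ?case by (intro exI[of _ "Suc l"] exI[of _ "case_nat c d"]) simp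
qed

section \<open>Interval digit sets and exchanging a digit\<close>

lemma digit_set_interval:
  fixes b z :: int
  assumes "b < 0"
  shows "digit_set b {z..<z - b}"
proof -
  have "\<exists>!d. d \<in> {z..<z - b} \<and> [d = a] (mod b)" for a
  proof (rule ex1I)
    let ?d = "z + (a - z) mod (- b)"
    have "[?d = z + (a - z)] (mod - b)"
      by (intro cong_add cong_refl) (simp add: cong_def)
    then show "?d \<in> {z..<z - b} \<and> [?d = a] (mod b)"
      using assms pos_mod_bound[of "- b" "a - z"] by simp
    fix d assume d: "d \<in> {z..<z - b} \<and> [d = a] (mod b)"
    then have "[d - z = a - z] (mod - b)"
      by (simp add: cong_diff)
    then have "(d - z) mod (- b) = (a - z) mod (- b)" by (simp only: cong_def)
    moreover have "(d - z) mod (- b) = d - z" using d by (intro mod_pos_pos_trivial) auto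
    ultimately show "d = ?d" by simp
  qed
  then show ?thesis using assms by (simp add: digit_set_def)
qed

lemma digit_set_unique:
  assumes "digit_set b D" "c \<in> D" "d \<in> D" "[c = d] (mod b)"
  shows "c = d"
  using assms unfolding digit_set_def by (metis cong_refl)

lemma digit_set_replace:
  assumes D: "digit_set b D" and "e \<in> D" and e': "[e' = e] (mod b)"
  shows "digit_set b (insert e' (D - {e}))"
proof -
  have notin: "e' \<notin> D - {e}"
    using digit_set_unique[OF D _ \<open>e \<in> D\<close> e'] by blast
  have "\<exists>!d. d \<in> insert e' (D - {e}) \<and> [d = a] (mod b)" for a
  proof -
    have "\<exists>!d. d \<in> D \<and> [d = a] (mod b)" using D by (simp add: digit_set_def)
    then obtain d where d: "d \<in> D" "[d = a] (mod b)"
      and u: "\<And>c. c \<in> D \<Longrightarrow> [c = a] (mod b) \<Longrightarrow> c = d"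
      by (elim ex1E) blast
    show ?thesis
    proof (cases "d = e")
      case True
      then have "[e' = a] (mod b)" using d e' cong_trans by blast
      then show ?thesis using True u by (intro ex1I[of _ e']) auto
    next
      case False
      then have "\<not> [e' = a] (mod b)"
        using u[OF \<open>e \<in> D\<close>] e' by (metis cong_sym cong_trans)
      then show ?thesis using d u False by (intro ex1I[of _ d]) blast+
    qed
  qed
  moreover have "card (insert e' (D - {e})) = card D"
  proof -
    have "finite D" using D by (simp add: digit_set_def)
    then show ?thesis
      using notin card_Suc_Diff1[OF _ \<open>e \<in> D\<close>] card_insert_disjoint[of "D - {e}" e'] by simp
  qed
  ultimately show ?thesis using D by (simp add: digit_set_def)
qed

section \<open>Sums of distinct powers of the base\<close>

definition power_sums :: "int \<Rightarrow> nat \<Rightarrow> int set" where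
  "power_sums b k = (\<lambda>J. \<Sum>j\<in>J. b ^ j) ` Pow {..<k}"

lemma zero_in_power_sums: "0 \<in> power_sums b k"
  unfolding power_sums_def by (rule image_eqI[of _ _ "{}"]) auto

lemma power_sums_mono: "p \<in> power_sums b k \<Longrightarrow> p \<in> power_sums b (Suc k)"
  unfolding power_sums_def by (auto simp: less_Suc_eq subset_iff intro!: imageI)

lemma power_sums_add_top:
  assumes "p \<in> power_sums b k"
  shows "p + b ^ k \<in> power_sums b (Suc k)"
proof -
  obtain J where J: "J \<subseteq> {..<k}" "p = (\<Sum>j\<in>J. b ^ j)"
    using assms unfolding power_sums_def by auto
  then have "finite J" "k \<notin> J" by (auto intro: finite_subset)
  then have "p + b ^ k = (\<Sum>j\<in>insert k J. b ^ j)" using J by simp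
  moreover have "insert k J \<in> Pow {..<Suc k}" using J by auto
  ultimately show ?thesis unfolding power_sums_def by (rule image_eqI)
qed

text \<open>Dividing by \<open>b\<close> shifts all exponents down by one. This frees the top
  exponent, so a carried power can be added without repetition.\<close>

lemma power_sums_SucE:
  assumes "p \<in> power_sums b (Suc k)"
  obtains x p' where "x \<in> {0, 1}" "p' \<in> power_sums b k" "p = x + b * p'"
proof -
  obtain J where J: "J \<subseteq> {..<Suc k}" "p = (\<Sum>j\<in>J. b ^ j)"
    using assms unfolding power_sums_def by auto
  define K where "K = {j. Suc j \<in> J}"
  define x :: int where "x = (if 0 \<in> J then 1 else 0)"
  have fin: "finite J" using J(1) finite_subset by blast
  have K: "K \<subseteq> {..<k}" using J(1) by (auto simp: K_def)
  have J0: "J - {0} = Suc ` K"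
    by (auto simp: K_def image_iff) (metis not0_implies_Suc)
  have "p = x + (\<Sum>j\<in>J - {0}. b ^ j)"
    using J(2) fin by (auto simp: x_def sum.remove)
  also have "(\<Sum>j\<in>J - {0}. b ^ j) = b * (\<Sum>j\<in>K. b ^ j)"
    unfolding J0 by (simp add: sum.reindex sum_distrib_left)
  finally have "p = x + b * (\<Sum>j\<in>K. b ^ j)" .
  moreover have "(\<Sum>j\<in>K. b ^ j) \<in> power_sums b k"
    using K unfolding power_sums_def by auto
  ultimately show ?thesis using that[of x] by (auto simp: x_def)
qed

section \<open>Validity of the modified interval digit sets\<close>

definition shifted_digits :: "int \<Rightarrow> int \<Rightarrow> nat \<Rightarrow> int set" where
  "shifted_digits b z n = insert (3 - b ^ Suc n) ({z..<z - b} - {3})"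

lemma digit_set_shifted_digits:
  assumes "b \<le> -4" "z \<in> {0, 1}"
  shows "digit_set b (shifted_digits b z n)"
  unfolding shifted_digits_def
proof (rule digit_set_replace[OF digit_set_interval])
  show "[3 - b ^ Suc n = 3] (mod b)" by (simp add: cong_iff_dvd_diff)
qed (use assms in auto)

lemma representable_shifted_digits_small:
  assumes b: "b \<le> -4" and z: "z \<in> {0, 1}"
    and "s \<in> {0, 1}" "p \<in> power_sums b k"
  shows "representable b (shifted_digits b z n) (s + p)"
  using assms(3,4)
proof (induction k arbitrary: s p)
  case 0
  let ?R = "representable b (shifted_digits b z n)"
  have R1: "?R 1" using b z by (intro digit) (auto simp: shifted_digits_def)
  moreover have "?R 0"
  proof (cases "z = 0")
    case True
    then show ?thesis using b by (intro digit) (auto simp: shifted_digits_def)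
  next
    case False
    \<comment> \<open>Here \<open>z = 1\<close>, and \<open>0\<close> gets the two-digit expansion
      with digits \<open>- b\<close> and \<open>1\<close>.\<close>
    then have "?R (- b + b * 1)"
      using R1 b z by (intro step) (auto simp: shifted_digits_def)
    then show ?thesis by simp
  qed
  ultimately show ?case using 0 by (auto simp: power_sums_def)
next
  case (Suc k)
  obtain x p' where x: "x \<in> {0, 1}" "p' \<in> power_sums b k" "p = x + b * p'"
    using Suc.prems(2) by (rule power_sums_SucE)
  \<comment> \<open>The sum \<open>s + x\<close> is one of \<open>0\<close>, \<open>1\<close>,
    \<open>2\<close>. It is itself a digit unless it is \<open>0\<close> and \<open>z = 1\<close>;
    then the digit is \<open>- b\<close> and the carry is \<open>1\<close>.\<close>
  define t :: int where "t = (if s + x < z then 1 else 0)"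
  have "s + x - b * t \<in> shifted_digits b z n"
    using Suc.prems(1) x(1) b z by (auto simp: t_def shifted_digits_def)
  moreover have "representable b (shifted_digits b z n) (t + p')"
    by (rule Suc.IH) (auto simp: t_def x)
  ultimately have "representable b (shifted_digits b z n) (s + x - b * t + b * (t + p'))"
    by (rule step)
  then show ?case by (simp add: x(3) algebra_simps)
qed

text \<open>If \<open>t\<close> were at least as large as \<open>s\<close> in absolute value,
  \<open>\<bar>b\<bar> * \<bar>t\<bar>\<close> would be at most
  \<open>\<bar>t\<bar> + \<bar>b\<bar>\<close>, which fails for \<open>\<bar>t\<bar> \<ge> 2\<close>
  and \<open>\<bar>b\<bar> \<ge> 4\<close>. The value \<open>s = -1\<close> is excluded because it
  can be sent to \<open>t = 1\<close>.\<close>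

lemma abs_quotient_less:
  fixes b z s x :: int
  assumes "b \<le> -4" "z \<in> {0, 1}" "x \<in> {0, 1}" "s \<notin> {-1, 0, 1}"
    and "s + x = d + b * t" "d \<in> {z..<z - b}"
  shows "\<bar>t\<bar> < \<bar>s\<bar>"
proof (rule ccontr)
  assume "\<not> ?thesis"
  then have le: "\<bar>s\<bar> \<le> \<bar>t\<bar>" "2 \<le> \<bar>t\<bar>" using assms(4) by auto
  have "- b * \<bar>t\<bar> = \<bar>s + x - d\<bar>" using assms(1,5) by (simp add: abs_mult)
  also have "\<dots> \<le> \<bar>t\<bar> - b" using assms le by auto
  finally have "(- b - 1) * (\<bar>t\<bar> - 1) \<le> 1" by (simp add: algebra_simps)
  moreover have "3 * 1 \<le> (- b - 1) * (\<bar>t\<bar> - 1)"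
    using assms(1) le by (intro mult_mono) auto
  ultimately show False by simp
qed

text \<open>The bound \<open>Suc n\<close> on the exponents is preserved by a step: the quotient
  only has exponents below \<open>n\<close>, so the \<open>b ^ n\<close> produced by the digit
  \<open>3\<close> is a new power.\<close>

lemma representable_shifted_digits:
  assumes b: "b \<le> -4" and z: "z \<in> {0, 1}" and "p \<in> power_sums b (Suc n)"
  shows "representable b (shifted_digits b z n) (s + p)"
  using assms(3)
proof (induction "nat \<bar>s\<bar>" arbitrary: s p rule: less_induct)
  case less
  let ?D = "shifted_digits b z n"
  show ?case
  proof (cases "s \<in> {0, 1}")
    case True
    then show ?thesis using representable_shifted_digits_small b z less.prems by blast
  next
    case False
    obtain x p' where x: "x \<in> {0, 1}" "p' \<in> power_sums b n" "p = x + b * p'"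
      using less.prems by (rule power_sums_SucE)
    have "digit_set b {z..<z - b}" using b by (intro digit_set_interval) simp
    then have "\<exists>!d. d \<in> {z..<z - b} \<and> [d = s + x] (mod b)"
      unfolding digit_set_def by blast
    then obtain d where d: "d \<in> {z..<z - b}" "[d = s + x] (mod b)" by blast
    then obtain t where t: "s + x = d + b * t"
      unfolding cong_iff_lin by auto
    \<comment> \<open>Stated for every \<open>q\<close>, since the rest is \<open>p' + b ^ n\<close>
      or \<open>p'\<close> according to whether \<open>d = 3\<close>. For \<open>s = -1\<close> the
      absolute value need not drop, but \<open>t\<close> lands in \<open>{0, 1}\<close>.\<close>
    have R: "representable b ?D (t + q)" if q: "q \<in> power_sums b (Suc n)" for q
    proof (cases "s = -1")
      case True
      have "t \<in> {0, 1}"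
      proof -
        have "b * t < 1" "b - 1 \<le> b * t" using True t d(1) x(1) b z by auto
        moreover have "b * t \<ge> 1" if "t < 0"
          using that b mult_neg_neg[of b t] by linarith
        moreover have "b * t \<le> b * 2" if "t \<ge> 2"
          using that b by (intro mult_left_mono_neg) auto
        ultimately have "\<not> t < 0" "\<not> t \<ge> 2" using b by linarith+
        then show ?thesis by auto
      qed
      then show ?thesis using representable_shifted_digits_small b z q by blast
    next
      case False
      then have "\<bar>t\<bar> < \<bar>s\<bar>"
        using abs_quotient_less[OF b z x(1) _ t d(1)] \<open>s \<notin> {0, 1}\<close> by blast
      then show ?thesis using less.hyps q by simp
    qed
    show ?thesis
    proof (cases "d = 3")
      case True
      have "3 - b ^ Suc n \<in> ?D" by (simp add: shifted_digits_def)
      then have "representable b ?D (3 - b ^ Suc n + b * (t + (p' + b ^ n)))"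
        by (intro step R power_sums_add_top x(2))
      also have "3 - b ^ Suc n + b * (t + (p' + b ^ n)) = s + p"
        using t x(3) True by (simp add: algebra_simps)
      finally show ?thesis .
    next
      case False
      then have "d \<in> ?D" using d by (simp add: shifted_digits_def)
      then have "representable b ?D (d + b * (t + p'))"
        by (intro step R power_sums_mono x(2))
      also have "d + b * (t + p') = s + p"
        using t x(3) by (simp add: algebra_simps)
      finally show ?thesis .
    qed
  qed
qed

lemma valid_shifted_digits:
  assumes "b \<le> -4" "z \<in> {0, 1}"
  shows "valid_digit_set b (shifted_digits b z n)"
  unfolding valid_digit_set_def
proof (intro conjI allI representable_imp_sum digit_set_shifted_digits assms)
  fix a
  show "representable b (shifted_digits b z n) a"
    using representable_shifted_digits[OF assms zero_in_power_sums, of n a] by simp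
qed

text \<open>The exchanged digits for different \<open>n\<close> are all congruent to
  \<open>3\<close>, so equal sets must have the same exchanged digit.\<close>

lemma inj_shifted_digits:
  assumes "b \<le> -4" "z \<in> {0, 1}"
  shows "inj (shifted_digits b z)"
proof (rule injI)
  fix m n
  assume "shifted_digits b z m = shifted_digits b z n"
  moreover have "3 - b ^ Suc m \<in> shifted_digits b z m" by (simp add: shifted_digits_def)
  ultimately have "3 - b ^ Suc m \<in> shifted_digits b z n" by simp
  moreover have "3 - b ^ Suc n \<in> shifted_digits b z n" by (simp add: shifted_digits_def)
  moreover have "[3 - b ^ Suc m = 3 - b ^ Suc n] (mod b)"
    by (simp add: cong_iff_dvd_diff)
  ultimately have "b ^ Suc m = b ^ Suc n"
    using digit_set_unique[OF digit_set_shifted_digits[OF assms]] by fastforce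
  then have "\<bar>b\<bar> ^ Suc m = \<bar>b\<bar> ^ Suc n" by (metis power_abs)
  then show "m = n" using assms(1) power_inject_exp[of "\<bar>b\<bar>" "Suc m" "Suc n"] by simp
qed

text \<open>The exchanged digit is never \<open>0\<close>, because \<open>b\<close> does not divide
  \<open>3\<close>; so only the interval matters.\<close>

lemma zero_in_shifted_digits_iff:
  assumes "b \<le> -4" "z \<in> {0, 1}"
  shows "0 \<in> shifted_digits b z n \<longleftrightarrow> z = 0"
proof -
  have "b ^ Suc n \<noteq> 3"
  proof
    assume "b ^ Suc n = 3"
    then have "b dvd 3" by (metis dvd_triv_left power_Suc)
    then show False using assms(1) zdvd_imp_le[of "- b" 3] by simp
  qed
  then show ?thesis using assms by (auto simp: shifted_digits_def)
qed

theorem corollary3p15: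
  fixes b :: int
  assumes "b \<le> -4"
  shows "infinite {D. valid_digit_set b D \<and> 0 \<in> D} \<and>
         infinite {D. valid_digit_set b D \<and> 0 \<notin> D}"
proof
  have "range (shifted_digits b 0) \<subseteq> {D. valid_digit_set b D \<and> 0 \<in> D}"
    using valid_shifted_digits[OF assms, of 0] zero_in_shifted_digits_iff[OF assms, of 0] by auto
  then show "infinite {D. valid_digit_set b D \<and> 0 \<in> D}"
    using inj_shifted_digits[OF assms, of 0] by (auto dest: finite_subset finite_imageD)
  have "range (shifted_digits b 1) \<subseteq> {D. valid_digit_set b D \<and> 0 \<notin> D}"
    using valid_shifted_digits[OF assms, of 1] zero_in_shifted_digits_iff[OF assms, of 1] by auto
  then show "infinite {D. valid_digit_set b D \<and> 0 \<notin> D}"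
    using inj_shifted_digits[OF assms, of 1] by (auto dest: finite_subset finite_imageD)
qed

end
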